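(* Let $n\ge 1$, $m\ge 2$, and let $T$ be a tiered tree on the vertex set $\{1,\dots,n\}$ with tiering function $t\colon\{1,\dots,n\}\to\{1,\dots,m\}$. Let $K_t$ be the graph on $\{1,\dots,n\}$ whose edges are all pairs $\{v,v'\}$ with $v>v'$ and $t(v)>t(v')$ (so $T$ is a spanning tree of $K_t$). Order the edges of $K_t$ lexicographically, identifying an edge $\{a,b\}$ with $a<b$ with the pair $(a,b)$. Then the weight $w(T)$ equals the external activity of $T$ in $K_t$, i.e. the number of edges $e$ of $K_t$ not in $T$ such that $e$ is the least edge (in this order) of the unique cycle contained in $T\cup\{e\}$.
   Context: A tiered tree with $m\ge 2$ levels is a tree $T$ with vertex set $\{1,\dots,n\}$ (vertices identified with their labels) together with a surjective function $t\colon \{1,\dots,n\}\to\{1,\dots,m\}$ (the tiering function) such that for any adjacent vertices $v,v'$ we have $t(v)\neq t(v')$, and if $v,v'$ are adjacent with $v>v'$ then $t(v)>t(v')$. The weight $w(T)$ is defined recursively (the definition makes sense for trees whose vertices are labeled by any finite set of integers, with a tiering function into an ordered set satisfying the same adjacency condition): if $T$ has a single vertex, $w(T)=0$. Otherwise let $v$ be the vertex with smallest label, and let $T_1,\dots,T_l$ be the connected components of the forest obtained by deleting $v$ (each with the restricted labels and tiering function). For each $i$, let $u_i\in T_i$ be the vertex of $T_i$ adjacent to $v$, and let $w_i$ be the number of vertices $u\in T_i$ with $t(u)>t(v)$ and $u<u_i$. Then $w(T)=\sum_{i=1}^{l}(w_i+w(T_i))$. *)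

theory Defs
  imports Main
begin

text \<open>Graphs are given by a vertex set \<open>V\<close> and a set \<open>E\<close> of two-element subsets of \<open>V\<close>.\<close>

definition simple_graph :: "'a set \<Rightarrow> 'a set set \<Rightarrow> bool" where
  "simple_graph V E \<longleftrightarrow> finite V \<and> (\<forall>e\<in>E. \<exists>u\<in>V. \<exists>v\<in>V. u \<noteq> v \<and> e = {u, v})"

definition adj_rel :: "'a set set \<Rightarrow> ('a \<times> 'a) set" where
  "adj_rel E = {(u, v). {u, v} \<in> E}"

definition induced_edges :: "'a set set \<Rightarrow> 'a set \<Rightarrow> 'a set set" where
  "induced_edges E W = {e \<in> E. e \<subseteq> W}"

definition conn_rel :: "'a set \<Rightarrow> 'a set set \<Rightarrow> ('a \<times> 'a) set" where
  "conn_rel V E = {(u, v). u \<in> V \<and> v \<in> V \<and> (u, v) \<in> (adj_rel (induced_edges E V))\<^sup>*}"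

definition connected_graph :: "'a set \<Rightarrow> 'a set set \<Rightarrow> bool" where
  "connected_graph V E \<longleftrightarrow> V \<noteq> {} \<and> (\<forall>u\<in>V. \<forall>v\<in>V. (u, v) \<in> conn_rel V E)"

text \<open>The vertex sets of the connected components of the subgraph induced on \<open>V\<close>;
  edges of \<open>E\<close> that leave \<open>V\<close> are ignored.\<close>

definition components :: "'a set \<Rightarrow> 'a set set \<Rightarrow> 'a set set" where
  "components V E = V // conn_rel V E"

text \<open>A cycle is represented by its edge set.\<close>

definition is_cycle :: "'a set set \<Rightarrow> bool" where
  "is_cycle C \<longleftrightarrow> (\<exists>xs. length xs \<ge> 3 \<and> distinct xs \<and>
     C = {{xs ! i, xs ! ((i + 1) mod length xs)} | i. i < length xs})"

definition is_tree :: "'a set \<Rightarrow> 'a set set \<Rightarrow> bool" where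
  "is_tree V E \<longleftrightarrow> simple_graph V E \<and> connected_graph V E \<and> (\<nexists>C. is_cycle C \<and> C \<subseteq> E)"

definition tiered_tree :: "nat \<Rightarrow> nat \<Rightarrow> nat set set \<Rightarrow> (nat \<Rightarrow> nat) \<Rightarrow> bool" where
  "tiered_tree n m E t \<longleftrightarrow> is_tree {1..n} E \<and> t ` {1..n} = {1..m} \<and>
     (\<forall>v v'. {v, v'} \<in> E \<longrightarrow> t v \<noteq> t v' \<and> (v > v' \<longrightarrow> t v > t v'))"

text \<open>In a tree, each component \<open>W\<close> left after deleting \<open>v\<close> contains exactly one
  neighbour of \<open>v\<close>, so the definite description below is well defined there.\<close>

definition attach_vertex :: "'a set set \<Rightarrow> 'a \<Rightarrow> 'a set \<Rightarrow> 'a" where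
  "attach_vertex E v W = (THE u. u \<in> W \<and> {u, v} \<in> E)"

definition local_weight :: "('a::linorder \<Rightarrow> 'b::linorder) \<Rightarrow> 'a set set \<Rightarrow> 'a \<Rightarrow> 'a set \<Rightarrow> nat" where
  "local_weight t E v W = card {u \<in> W. t u > t v \<and> u < attach_vertex E v W}"

lemma components_subset: "W \<in> components V E \<Longrightarrow> W \<subseteq> V"
  by (auto simp: components_def conn_rel_def quotient_def)

text \<open>The guard makes the recursion total; on trees it separates the one-vertex case from
  the recursive one.\<close>

function weight :: "('a::linorder \<Rightarrow> 'b::linorder) \<Rightarrow> 'a set \<Rightarrow> 'a set set \<Rightarrow> nat" where
  "weight t V E =
     (if finite V \<and> card V > 1 then
        (\<Sum>W\<in>components (V - {Min V}) E.
           local_weight t E (Min V) W + weight t W (induced_edges E W))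
      else 0)"
  by pat_completeness auto

termination
proof (relation "measure (\<lambda>(t, V, E). card V)", simp)
  fix t :: "'a::linorder \<Rightarrow> 'b::linorder" and V W :: "'a set" and E
  assume V: "finite V \<and> 1 < card V" and W: "W \<in> components (V - {Min V}) E"
  have "Min V \<in> V"
    using V by (intro Min_in) auto
  then have "W \<subset> V"
    using components_subset[OF W] by auto
  then show "((t, W, induced_edges E W), t, V, E) \<in> measure (\<lambda>(t, V, E). card V)"
    using V by (simp add: psubset_card_mono)
qed

declare weight.simps [simp del]

definition tier_graph :: "nat \<Rightarrow> (nat \<Rightarrow> nat) \<Rightarrow> nat set set" where
  "tier_graph n t = {{v, v'} | v v'. v \<in> {1..n} \<and> v' \<in> {1..n} \<and> v > v' \<and> t v > t v'}"

text \<open>For edges \<open>{a, b}\<close> with \<open>a < b\<close>, the lexicographic order on the pairs \<open>(a, b)\<close>.\<close>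

definition edge_le :: "nat set \<Rightarrow> nat set \<Rightarrow> bool" where
  "edge_le e f \<longleftrightarrow> Min e < Min f \<or> (Min e = Min f \<and> Max e \<le> Max f)"

definition fundamental_cycle :: "'a set set \<Rightarrow> 'a set \<Rightarrow> 'a set set" where
  "fundamental_cycle T e = (THE C. is_cycle C \<and> C \<subseteq> insert e T)"

definition external_activity ::
    "('a set \<Rightarrow> 'a set \<Rightarrow> bool) \<Rightarrow> 'a set set \<Rightarrow> 'a set set \<Rightarrow> nat" where
  "external_activity le G T =
     card {e \<in> G - T. e \<in> fundamental_cycle T e \<and> (\<forall>f\<in>fundamental_cycle T e. le e f)}"

end

(* Let v be the least vertex. An edge of K_t is externally active either because it has the form
   {v, u} with u below the neighbour of v in the component of u, or because its fundamental cycle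
   avoids v; in the latter case it lies inside one component of T - v and is active there. So both
   sides satisfy the same recursion. Fundamental cycles are handled through separating edges: an
   edge of T lies on the cycle of T + {a, b} iff its removal from T disconnects a from b. *)

theory Submission
  imports Defs
begin

section \<open>Reachability and cycles\<close>

text \<open>Unlike \<open>conn_rel\<close>, this carries no vertex set, so deleting an edge is a
  plain set difference.\<close>

abbreviation reach :: "'a set set \<Rightarrow> ('a \<times> 'a) set" where
  "reach F \<equiv> (adj_rel F)\<^sup>*"

lemma reach_sym: "(x, y) \<in> reach F \<Longrightarrow> (y, x) \<in> reach F"
  by (rule symD[OF sym_rtrancl]) (auto simp: sym_def adj_rel_def insert_commute)

lemma reach_mono: "(x, y) \<in> reach F \<Longrightarrow> F \<subseteq> G \<Longrightarrow> (x, y) \<in> reach G"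
  by (rule rtrancl_mono[THEN subsetD, of "adj_rel F"]) (auto simp: adj_rel_def)

lemma reach_edge: "{x, y} \<in> F \<Longrightarrow> (x, y) \<in> reach F"
  by (auto simp: adj_rel_def)

lemma reach_trans: "(x, y) \<in> reach F \<Longrightarrow> (y, z) \<in> reach F \<Longrightarrow> (x, z) \<in> reach F"
  by (rule rtrancl_trans)

text \<open>Each use of \<open>{a, b}\<close> in a walk is replaced by a detour through
  \<open>F\<close>.\<close>

lemma reach_replace_edge:
  assumes "(x, y) \<in> reach (insert {a, b} F)" "(a, b) \<in> reach F"
  shows "(x, y) \<in> reach F"
  using assms(1)
proof induction
  case (step y z)
  have "(y, z) \<in> reach F"
  proof (cases "{y, z} = {a, b}")
    case True
    then show ?thesis using assms(2) reach_sym by (auto simp: doubleton_eq_iff)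
  next
    case False
    then show ?thesis using step.hyps(2) by (auto simp: adj_rel_def)
  qed
  then show ?case using step.IH reach_trans by fast
qed simp

lemma reach_simple_path:
  assumes "(x, y) \<in> reach F"
  obtains xs where "xs \<noteq> []" "hd xs = x" "last xs = y" "distinct xs"
    "successively (\<lambda>u v. {u, v} \<in> F) xs"
proof -
  have "\<exists>xs. xs \<noteq> [] \<and> hd xs = x \<and> last xs = y \<and> distinct xs
      \<and> successively (\<lambda>u v. {u, v} \<in> F) xs"
    using assms
  proof induction
    case base
    show ?case by (intro exI[of _ "[x]"]) simp
  next
    case (step y z)
    then obtain xs where xs: "xs \<noteq> []" "hd xs = x" "last xs = y" "distinct xs"
      "successively (\<lambda>u v. {u, v} \<in> F) xs" by blast
    have yz: "{y, z} \<in> F" using step.hyps by (auto simp: adj_rel_def)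
    show ?case
    proof (cases "z \<in> set xs")
      case True
      \<comment> \<open>Since \<open>z\<close> already lies on the path, the path is cut off at
        \<open>z\<close> instead of being extended.\<close>
      then obtain as bs where "xs = as @ z # bs" by (meson split_list)
      then show ?thesis using xs
        by (intro exI[of _ "as @ [z]"]) (auto simp: successively_append_iff hd_append)
    next
      case False
      then show ?thesis using xs yz
        by (intro exI[of _ "xs @ [z]"]) (auto simp: successively_append_iff)
    qed
  qed
  then show ?thesis using that by blast
qed

text \<open>A simple path in \<open>F\<close> from \<open>x\<close> to \<open>y\<close> is closed up
  by \<open>{x, y}\<close>. The conditions \<open>x \<noteq> y\<close> and
  \<open>{x, y} \<notin> F\<close> exclude paths on one or two vertices, which would give no
  cycle.\<close>

lemma cycle_of_reach:
  assumes "(x, y) \<in> reach F" "x \<noteq> y" "{x, y} \<notin> F"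
  obtains C where "is_cycle C" "C \<subseteq> insert {x, y} F"
proof -
  obtain xs where xs: "xs \<noteq> []" "hd xs = x" "last xs = y" "distinct xs"
    "successively (\<lambda>u v. {u, v} \<in> F) xs"
    using reach_simple_path[OF assms(1)] .
  define C where "C = {{xs ! i, xs ! ((i + 1) mod length xs)} | i. i < length xs}"
  have x: "x = xs ! 0" and y: "y = xs ! (length xs - 1)"
    using xs by (auto simp: hd_conv_nth last_conv_nth)
  have F: "{xs ! i, xs ! Suc i} \<in> F" if "Suc i < length xs" for i
    using xs(5) that by (simp add: successively_conv_nth)
  have "length xs \<noteq> 1" using x y assms(2) by auto
  moreover have "length xs \<noteq> 2" using F[of 0] x y assms(3) by auto
  moreover have "length xs \<noteq> 0" using xs(1) by simp
  ultimately have "length xs \<ge> 3" by linarith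
  then have "is_cycle C" unfolding is_cycle_def C_def using xs(4) by blast
  moreover have "{xs ! i, xs ! ((i + 1) mod length xs)} \<in> insert {x, y} F"
    if "i < length xs" for i
  proof (cases "Suc i < length xs")
    case True
    then show ?thesis using F by simp
  next
    case False
    \<comment> \<open>At the last index the successor wraps round to 0, which gives the closing edge
      \<open>{x, y}\<close>.\<close>
    then have "Suc i = length xs" using that by simp
    moreover from this have "i = length xs - 1" by simp
    ultimately show ?thesis using x y by (simp add: insert_commute)
  qed
  then have "C \<subseteq> insert {x, y} F" unfolding C_def by blast
  ultimately show ?thesis using that by blast
qed

text \<open>The two ends of the removed edge are joined by going round the cycle the other
  way.\<close>

lemma cycle_reach_without_edge:
  assumes "is_cycle C" "{x, y} \<in> C"
  shows "(x, y) \<in> reach (C - {{x, y}})"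
proof -
  obtain xs where xs: "length xs \<ge> 3" "distinct xs"
    "C = {{xs ! i, xs ! ((i + 1) mod length xs)} | i. i < length xs}"
    using assms(1) unfolding is_cycle_def by blast
  let ?n = "length xs"
  obtain i where i: "i < ?n" "{x, y} = {xs ! i, xs ! ((i + 1) mod ?n)}"
    using assms(2) xs(3) by auto
  \<comment> \<open>\<open>p\<close> walks round the cycle starting just after the removed edge, so
    \<open>p (?n - 1)\<close> and \<open>p 0\<close> are the two ends of that edge.\<close>
  define p where "p k = xs ! ((i + 1 + k) mod ?n)" for k
  have inj: "j = k" if "p j = p k" "j < ?n" "k < ?n" for j k
    using that xs(2) nth_eq_iff_index_eq[of "rotate (i + 1) xs" j k]
    by (simp add: p_def nth_rotate del: rotate_Suc)
  have last: "p (?n - 1) = xs ! i" and first: "p 0 = xs ! ((i + 1) mod ?n)"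
  proof -
    have "i + 1 + (?n - 1) = i + ?n" using i(1) by simp
    then show "p (?n - 1) = xs ! i" using i(1) by (simp add: p_def)
  qed (use i(1) in \<open>auto simp: p_def\<close>)
  have edge: "{p k, p (Suc k)} \<in> C - {{x, y}}" if "Suc k < ?n" for k
  proof -
    define l where "l = (i + 1 + k) mod ?n"
    have "p k = xs ! l" "p (Suc k) = xs ! ((l + 1) mod ?n)"
      unfolding p_def l_def by (simp_all add: mod_simps)
    moreover have "l < ?n" unfolding l_def using i(1) by (intro mod_less_divisor) auto
    ultimately have "{p k, p (Suc k)} \<in> C"
      unfolding xs(3) by (intro CollectI exI[of _ l]) simp
    \<comment> \<open>Equality would force \<open>k = ?n - 1\<close>, against
      \<open>Suc k < ?n\<close>, or \<open>k = 0\<close> and \<open>?n = 2\<close>, against the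
      length bound.\<close>
    moreover have "{p k, p (Suc k)} \<noteq> {p (?n - 1), p 0}"
      using inj[of k "?n - 1"] inj[of k 0] inj[of "Suc k" "?n - 1"] that xs(1)
      by (cases "xs = []") (auto simp: doubleton_eq_iff)
    ultimately show ?thesis using i(2) last first by auto
  qed
  have "(p 0, p k) \<in> reach (C - {{x, y}})" if "k < ?n" for k
    using that
  proof (induction k)
    case (Suc k)
    then show ?case using reach_edge[OF edge[of k]] reach_trans
      by (metis Suc_lessD)
  qed simp
  from this[of "?n - 1"] have r: "(p 0, p (?n - 1)) \<in> reach (C - {{x, y}})" using i(1) by simp
  have "x = p (?n - 1) \<and> y = p 0 \<or> x = p 0 \<and> y = p (?n - 1)"
    using i(2) last first by (simp add: doubleton_eq_iff)
  then show ?thesis using r reach_sym[OF r] by metis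
qed

section \<open>Fundamental cycles of trees\<close>

lemma is_tree_edgeE:
  assumes "is_tree V T" "e \<in> T"
  obtains x y where "e = {x, y}" "x \<in> V" "y \<in> V" "x \<noteq> y"
  using assms unfolding is_tree_def simple_graph_def by blast

lemma is_tree_reach:
  assumes "is_tree V T" "x \<in> V" "y \<in> V"
  shows "(x, y) \<in> reach T"
  using assms unfolding is_tree_def connected_graph_def conn_rel_def
  by (auto simp: induced_edges_def intro: reach_mono)

text \<open>If the ends stayed connected, the edge would close a cycle inside
  \<open>T\<close>.\<close>

lemma is_tree_edge_separates:
  assumes "is_tree V T" "{x, y} \<in> T"
  shows "(x, y) \<notin> reach (T - {{x, y}})"
proof
  assume r: "(x, y) \<in> reach (T - {{x, y}})"
  have "x \<noteq> y" using is_tree_edgeE[OF assms] by (metis insert_absorb2 doubleton_eq_iff)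
  then obtain C where "is_cycle C" "C \<subseteq> insert {x, y} (T - {{x, y}})"
    using cycle_of_reach[OF r] by auto
  then show False using assms unfolding is_tree_def by (metis insert_Diff)
qed

text \<open>If \<open>f\<close> is not on \<open>C\<close>, the rest of \<open>C\<close> joins
  \<open>a\<close> to \<open>b\<close> in \<open>T - {f}\<close>. If \<open>f\<close> is on
  \<open>C\<close> and \<open>a\<close>, \<open>b\<close> were still joined in
  \<open>T - {f}\<close>, rerouting \<open>C - {f}\<close> around \<open>{a, b}\<close> would join
  the ends of \<open>f\<close> without \<open>f\<close>, which a tree forbids. The right-hand side
  does not mention \<open>C\<close>, so uniqueness of the cycle follows as well.\<close>

lemma tree_cycle_eq:
  assumes T: "is_tree V T" and C: "is_cycle C" "C \<subseteq> insert {a, b} T"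
  shows "C = insert {a, b} {f \<in> T. (a, b) \<notin> reach (T - {f})}"
proof -
  have e: "{a, b} \<in> C" using assms unfolding is_tree_def by blast
  have ab: "(a, b) \<in> reach (C - {{a, b}})" using cycle_reach_without_edge[OF C(1) e] .
  have "f \<in> C" if "f \<in> T" "(a, b) \<notin> reach (T - {f})" for f
    using reach_mono[OF ab, of "T - {f}"] that C(2) by auto
  moreover have "(a, b) \<notin> reach (T - {f})" if f: "f \<in> C" "f \<noteq> {a, b}" for f
  proof
    assume r: "(a, b) \<in> reach (T - {f})"
    have fT: "f \<in> T" using f C(2) by auto
    then obtain x y where xy: "f = {x, y}" using is_tree_edgeE[OF T] by metis
    have "(x, y) \<in> reach (C - {f})" using cycle_reach_without_edge[OF C(1)] f(1) xy by simp
    then have "(x, y) \<in> reach (insert {a, b} (T - {f}))"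
      by (rule reach_mono) (use C(2) in auto)
    then have "(x, y) \<in> reach (T - {f})" using reach_replace_edge r by fast
    then show False using is_tree_edge_separates[OF T] fT xy by simp
  qed
  ultimately show ?thesis using C(2) e by auto
qed

lemma fundamental_cycle_eqI:
  assumes "is_tree V T" "is_cycle C" "C \<subseteq> insert {a, b} T"
  shows "fundamental_cycle T {a, b} = C"
  unfolding fundamental_cycle_def
proof (rule the_equality)
  fix C' assume "is_cycle C' \<and> C' \<subseteq> insert {a, b} T"
  then have "C' = insert {a, b} {f \<in> T. (a, b) \<notin> reach (T - {f})}"
    by (intro tree_cycle_eq[OF assms(1)]) simp_all
  then show "C' = C" using tree_cycle_eq[OF assms, symmetric] by (rule trans)
qed (use assms in simp)

lemma fundamental_cycle_is_cycle:
  assumes "is_tree V T" "a \<in> V" "b \<in> V" "a \<noteq> b" "{a, b} \<notin> T"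
  shows "is_cycle (fundamental_cycle T {a, b})"
    and "fundamental_cycle T {a, b} \<subseteq> insert {a, b} T"
proof -
  obtain C where C: "is_cycle C" "C \<subseteq> insert {a, b} T"
    using cycle_of_reach[OF is_tree_reach[OF assms(1-3)] assms(4,5)] .
  then have "fundamental_cycle T {a, b} = C" using fundamental_cycle_eqI[OF assms(1)] by blast
  then show "is_cycle (fundamental_cycle T {a, b})"
    and "fundamental_cycle T {a, b} \<subseteq> insert {a, b} T" using C by simp_all
qed

lemma fundamental_cycle_eq:
  assumes "is_tree V T" "a \<in> V" "b \<in> V" "a \<noteq> b" "{a, b} \<notin> T"
  shows "fundamental_cycle T {a, b} = insert {a, b} {f \<in> T. (a, b) \<notin> reach (T - {f})}"
  by (rule tree_cycle_eq[OF assms(1) fundamental_cycle_is_cycle[OF assms]])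

section \<open>Deleting a vertex from a tree\<close>

lemma equiv_conn_rel: "equiv V (conn_rel V E)"
  unfolding conn_rel_def
  by (intro equivI refl_onI symI transI) (auto intro: reach_sym reach_trans)

lemma Union_components: "\<Union> (components V E) = V"
  unfolding components_def by (rule Union_quotient[OF equiv_conn_rel])

lemma components_disjoint:
  "W \<in> components V E \<Longrightarrow> W' \<in> components V E \<Longrightarrow> W \<noteq> W' \<Longrightarrow> W \<inter> W' = {}"
  unfolding components_def using quotient_disj[OF equiv_conn_rel] by blast

lemma component_nonempty: "W \<in> components V E \<Longrightarrow> W \<noteq> {}"
  unfolding components_def using in_quotient_imp_non_empty[OF equiv_conn_rel] by blast

lemma component_closed:
  assumes "W \<in> components V E" "x \<in> W" "{x, y} \<in> E" "y \<in> V"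
  shows "y \<in> W"
proof -
  have "x \<in> V" using assms components_subset by blast
  then have "(x, y) \<in> conn_rel V E"
    using assms unfolding conn_rel_def by (auto simp: induced_edges_def intro!: reach_edge)
  then show ?thesis
    using in_quotient_imp_closed[OF equiv_conn_rel assms(1)[unfolded components_def] assms(2)]
    by simp
qed

text \<open>A walk in \<open>V\<close> that starts in \<open>W\<close> never leaves
  \<open>W\<close>, by closure under adjacency. The induction therefore also carries
  \<open>y \<in> W\<close>.\<close>

lemma component_reach:
  assumes W: "W \<in> components V E" and "x \<in> W" "y \<in> W"
  shows "(x, y) \<in> reach (induced_edges E W)"
proof -
  have "(x, y) \<in> conn_rel V E"
    using assms in_quotient_imp_in_rel[OF equiv_conn_rel] unfolding components_def by fastforce
  then have "(x, y) \<in> reach (induced_edges E V)" unfolding conn_rel_def by simp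
  then have "y \<in> W \<and> (x, y) \<in> reach (induced_edges E W)"
  proof induction
    case base
    then show ?case using assms by simp
  next
    case (step y z)
    then have yz: "{y, z} \<in> E" "z \<in> V" by (auto simp: adj_rel_def induced_edges_def)
    then have z: "z \<in> W" using component_closed[OF W] step.IH by blast
    then have "{y, z} \<in> induced_edges E W" using yz step.IH by (simp add: induced_edges_def)
    then show ?case using z step.IH reach_trans reach_edge by metis
  qed
  then show ?thesis by simp
qed

lemma is_tree_component:
  assumes "is_tree V T" "W \<in> components (V - {v}) T"
  shows "is_tree W (induced_edges T W)"
proof -
  have sub: "W \<subseteq> V" using components_subset[OF assms(2)] by blast
  have "induced_edges (induced_edges T W) W = induced_edges T W"
    by (auto simp: induced_edges_def)
  then have "connected_graph W (induced_edges T W)"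
    using component_nonempty[OF assms(2)] component_reach[OF assms(2)]
    unfolding connected_graph_def conn_rel_def by simp
  moreover have "simple_graph W (induced_edges T W)"
    using assms(1) sub finite_subset unfolding is_tree_def simple_graph_def
    by (fastforce simp: induced_edges_def)
  ultimately show ?thesis using assms(1) unfolding is_tree_def induced_edges_def by blast
qed

section \<open>The edges joining a deleted vertex to the remaining components\<close>

locale tree_minus_vertex =
  fixes V :: "'a set" and T :: "'a set set" and v :: 'a
  assumes tree: "is_tree V T" and v: "v \<in> V"
begin

text \<open>Edges inside \<open>W\<close> do not contain \<open>v\<close>, so none of them is
  \<open>f\<close>.\<close>

lemma component_reach_avoiding:
  assumes "W \<in> components (V - {v}) T" "x \<in> W" "y \<in> W" "v \<in> f"
  shows "(x, y) \<in> reach (T - {f})"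
proof -
  have "v \<notin> W" using assms components_subset by blast
  then show ?thesis
    using component_reach[OF assms(1-3)] assms(4)
    by (elim reach_mono) (auto simp: induced_edges_def)
qed

text \<open>Existence: a walk from \<open>W\<close> to \<open>v\<close> must leave \<open>W\<close>,
  and the only exit is an edge to \<open>v\<close>. Uniqueness: a second neighbour of
  \<open>v\<close> in \<open>W\<close> would give a detour around the first edge, which then would
  not separate its ends.\<close>

lemma ex1_attach_vertex:
  assumes W: "W \<in> components (V - {v}) T"
  shows "\<exists>!u. u \<in> W \<and> {u, v} \<in> T"
proof -
  obtain w where w: "w \<in> W" using component_nonempty[OF W] by blast
  have "v \<notin> W" using W components_subset by blast
  have "x \<in> W \<or> (\<exists>u\<in>W. {u, v} \<in> T)" if "(w, x) \<in> reach T" for x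
    using that
  proof induction
    case (step y z)
    have yz: "{y, z} \<in> T" using step.hyps by (auto simp: adj_rel_def)
    then have "z \<in> V" using tree unfolding is_tree_def simple_graph_def by (metis doubleton_eq_iff)
    then show ?case using step.IH yz component_closed[OF W] by (cases "z = v") blast+
  qed (use w in simp)
  moreover have "(w, v) \<in> reach T"
    using is_tree_reach[OF tree _ v] w W components_subset by blast
  moreover have "u = u'" if "u \<in> W" "{u, v} \<in> T" "u' \<in> W" "{u', v} \<in> T" for u u'
  proof (rule ccontr)
    assume "u \<noteq> u'"
    then have "{u', v} \<in> T - {{u, v}}" using that by (auto simp: doubleton_eq_iff)
    moreover have "(u, u') \<in> reach (T - {{u, v}})"
      using component_reach_avoiding[OF W] that by simp
    ultimately have "(u, v) \<in> reach (T - {{u, v}})" using reach_edge reach_trans by metis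
    then show False using is_tree_edge_separates[OF tree] that by blast
  qed
  ultimately show ?thesis using \<open>v \<notin> W\<close> by blast
qed

lemma attach_vertex:
  assumes "W \<in> components (V - {v}) T"
  shows "attach_vertex T v W \<in> W" "{attach_vertex T v W, v} \<in> T"
  using theI'[OF ex1_attach_vertex[OF assms]] unfolding attach_vertex_def by auto

lemma attach_vertex_eqI:
  assumes "W \<in> components (V - {v}) T" "u \<in> W" "{u, v} \<in> T"
  shows "u = attach_vertex T v W"
  using attach_vertex[OF assms(1)] ex1_attach_vertex[OF assms(1)] assms(2,3) by blast

text \<open>Inside \<open>W\<close>, \<open>u\<close> is joined to the attaching vertex without
  using the attaching edge, so reaching \<open>v\<close> as well would join the ends of that
  edge.\<close>

lemma attach_edge_separates:
  assumes W: "W \<in> components (V - {v}) T" and u: "u \<in> W"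
  shows "(u, v) \<notin> reach (T - {{attach_vertex T v W, v}})"
  using is_tree_edge_separates[OF tree attach_vertex(2)[OF W]]
    reach_trans[OF component_reach_avoiding[OF W attach_vertex(1)[OF W] u]] by blast

text \<open>The walk goes to the attaching vertex inside \<open>W\<close> and then along the
  attaching edge. Hence no other edge at \<open>v\<close> lies on the fundamental cycle of
  \<open>{u, v}\<close>.\<close>

lemma reach_avoiding_other_edge:
  assumes W: "W \<in> components (V - {v}) T" and u: "u \<in> W"
    and f: "v \<in> f" "f \<noteq> {attach_vertex T v W, v}"
  shows "(u, v) \<in> reach (T - {f})"
  by (rule reach_trans[OF component_reach_avoiding[OF W u attach_vertex(1)[OF W] f(1)] reach_edge])
    (use attach_vertex(2)[OF W] f(2) in simp)

text \<open>The vertex \<open>b\<close> still reaches \<open>v\<close> through the attaching edge of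
  \<open>W'\<close>, so a link from \<open>a\<close> to \<open>b\<close> would link \<open>a\<close>
  to \<open>v\<close>.\<close>

lemma attach_edge_separates_components:
  assumes W: "W \<in> components (V - {v}) T" "W' \<in> components (V - {v}) T" "W \<noteq> W'"
    and a: "a \<in> W" and b: "b \<in> W'"
  shows "(a, b) \<notin> reach (T - {{attach_vertex T v W, v}})"
proof
  assume r: "(a, b) \<in> reach (T - {{attach_vertex T v W, v}})"
  have "attach_vertex T v W \<noteq> attach_vertex T v W'"
    using attach_vertex(1)[OF W(1)] attach_vertex(1)[OF W(2)] components_disjoint[OF W] by auto
  then have "(b, v) \<in> reach (T - {{attach_vertex T v W, v}})"
    by (intro reach_avoiding_other_edge[OF W(2) b]) (auto simp: doubleton_eq_iff)
  then show False using reach_trans[OF r] attach_edge_separates[OF W(1) a] by blast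
qed

text \<open>The cycle formed in the component is also a cycle in \<open>insert {a, b} T\<close>,
  where there is only one.\<close>

lemma fundamental_cycle_component:
  assumes W: "W \<in> components (V - {v}) T"
    and ab: "a \<in> W" "b \<in> W" "a \<noteq> b" "{a, b} \<notin> T"
  shows "fundamental_cycle T {a, b} = fundamental_cycle (induced_edges T W) {a, b}"
proof (rule fundamental_cycle_eqI[OF tree])
  note c = fundamental_cycle_is_cycle[OF is_tree_component[OF tree W] ab(1-3)]
  have "{a, b} \<notin> induced_edges T W" using ab by (simp add: induced_edges_def)
  then show "is_cycle (fundamental_cycle (induced_edges T W) {a, b})"
    and "fundamental_cycle (induced_edges T W) {a, b} \<subseteq> insert {a, b} T"
    using c by (auto simp: induced_edges_def)
qed

end

section \<open>Externally active edges\<close>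

text \<open>\<open>tier_graph\<close> over an arbitrary vertex set, as the recursion descends to
  components that need not be intervals.\<close>

definition tier_edges :: "'a::linorder set \<Rightarrow> ('a \<Rightarrow> 'b::linorder) \<Rightarrow> 'a set set" where
  "tier_edges V t = {{v, v'} | v v'. v \<in> V \<and> v' \<in> V \<and> v > v' \<and> t v > t v'}"

text \<open>The set counted by \<open>external_activity\<close>, named so that it can be
  partitioned.\<close>

definition active_edges ::
    "('a set \<Rightarrow> 'a set \<Rightarrow> bool) \<Rightarrow> 'a set set \<Rightarrow> 'a set set \<Rightarrow> 'a set set" where
  "active_edges le G T =
     {e \<in> G - T. e \<in> fundamental_cycle T e \<and> (\<forall>f\<in>fundamental_cycle T e. le e f)}"

lemma external_activity_eq_card: "external_activity le G T = card (active_edges le G T)"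
  by (simp add: external_activity_def active_edges_def)

lemma finite_tier_edges: "finite V \<Longrightarrow> finite (tier_edges V t)"
  by (rule finite_subset[of _ "Pow V"]) (auto simp: tier_edges_def)

lemma finite_active_edges: "finite G \<Longrightarrow> finite (active_edges le G T)"
  by (simp add: active_edges_def)

lemma edge_le_refl: "edge_le e e"
  by (simp add: edge_le_def)

text \<open>Replaces cycles by separating edges. The edge \<open>{a, b}\<close> itself drops out of
  the comparison because \<open>edge_le\<close> is reflexive.\<close>

lemma active_edges_iff:
  assumes "is_tree V T" "a \<in> V" "b \<in> V" "a \<noteq> b"
  shows "{a, b} \<in> active_edges edge_le G T \<longleftrightarrow>
    {a, b} \<in> G - T \<and> (\<forall>f\<in>T. (a, b) \<notin> reach (T - {f}) \<longrightarrow> edge_le {a, b} f)"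
  using fundamental_cycle_eq[OF assms]
  by (cases "{a, b} \<in> T") (auto simp: active_edges_def edge_le_refl)

section \<open>Active edges sorted by their relation to the least vertex\<close>

locale tree_minus_Min = tree_minus_vertex V T v for V :: "nat set" and T v +
  assumes Min_V: "v = Min V"
begin

lemma Min_le_vertex: "x \<in> V \<Longrightarrow> v \<le> x"
  using tree Min_V unfolding is_tree_def simple_graph_def by auto

text \<open>Edges avoiding \<open>v\<close> have a larger minimum and so never precede
  \<open>{u, v}\<close>. The only tree edge at \<open>v\<close> on the cycle is the attaching edge,
  and comparing it with \<open>{u, v}\<close> amounts to comparing \<open>?u\<close> with
  \<open>u\<close>.\<close>

lemma active_edge_at_Min_iff:
  assumes W: "W \<in> components (V - {v}) T" and u: "u \<in> W"
  shows "{u, v} \<in> active_edges edge_le (tier_edges V t) T \<longleftrightarrow>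
    t v < t u \<and> u < attach_vertex T v W"
proof -
  let ?u = "attach_vertex T v W"
  have uV: "u \<in> V" "u \<noteq> v" using u components_subset[OF W] by auto
  then have vu: "v < u" using Min_le_vertex[OF uV(1)] by simp
  have u'V: "?u \<in> V" "?u \<noteq> v" using attach_vertex(1)[OF W] components_subset[OF W] by auto
  then have vu': "v < ?u" using Min_le_vertex[OF u'V(1)] by simp
  have K: "{u, v} \<in> tier_edges V t \<longleftrightarrow> t v < t u"
    using uV v vu by (auto simp: tier_edges_def doubleton_eq_iff)
  have T: "{u, v} \<in> T \<longleftrightarrow> u = ?u" using attach_vertex_eqI[OF W u] attach_vertex[OF W] by metis
  have minimal: "(\<forall>f\<in>T. (u, v) \<notin> reach (T - {f}) \<longrightarrow> edge_le {u, v} f) \<longleftrightarrow> u \<le> ?u"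
  proof
    assume "\<forall>f\<in>T. (u, v) \<notin> reach (T - {f}) \<longrightarrow> edge_le {u, v} f"
    then have "edge_le {u, v} {?u, v}"
      using attach_edge_separates[OF W u] attach_vertex(2)[OF W] by blast
    then show "u \<le> ?u" using vu vu' by (simp add: edge_le_def)
  next
    assume le: "u \<le> ?u"
    show "\<forall>f\<in>T. (u, v) \<notin> reach (T - {f}) \<longrightarrow> edge_le {u, v} f"
    proof (intro ballI impI)
      fix f assume f: "f \<in> T" "(u, v) \<notin> reach (T - {f})"
      show "edge_le {u, v} f"
      proof (cases "v \<in> f")
        case True
        then have "f = {?u, v}" using reach_avoiding_other_edge[OF W u] f(2) by blast
        then show ?thesis using le vu vu' by (simp add: edge_le_def)
      next
        case False
        obtain x y where xy: "f = {x, y}" "x \<in> V" "y \<in> V" using is_tree_edgeE[OF tree f(1)] .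
        then have "v < x" "v < y" using False Min_le_vertex by (auto simp: order.strict_iff_order)
        then show ?thesis using xy(1) vu by (simp add: edge_le_def)
      qed
    qed
  qed
  show ?thesis
    unfolding active_edges_iff[OF tree uV(1) v uV(2)] Diff_iff K T minimal by auto
qed

text \<open>For non-tree edges inside \<open>W\<close> the two fundamental cycles coincide, and the
  edge order is the same on both sides.\<close>

lemma active_edges_component:
  assumes W: "W \<in> components (V - {v}) T"
  shows "active_edges edge_le (tier_edges W t) (induced_edges T W) =
    {e \<in> active_edges edge_le (tier_edges V t) T. e \<subseteq> W}"
proof (intro set_eqI)
  fix e
  have WV: "W \<subseteq> V" using components_subset[OF W] by auto
  have K: "e \<in> tier_edges W t \<longleftrightarrow> e \<in> tier_edges V t \<and> e \<subseteq> W"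
    using WV unfolding tier_edges_def by blast
  have "fundamental_cycle T e = fundamental_cycle (induced_edges T W) e"
    if "e \<in> tier_edges W t" "e \<notin> T"
    using that fundamental_cycle_component[OF W] by (auto simp: tier_edges_def)
  then show "e \<in> active_edges edge_le (tier_edges W t) (induced_edges T W) \<longleftrightarrow>
      e \<in> {e \<in> active_edges edge_le (tier_edges V t) T. e \<subseteq> W}"
    using K unfolding active_edges_def induced_edges_def by auto
qed

text \<open>An edge between two components cannot be active: its cycle runs through \<open>v\<close>
  and contains an attaching edge, which is smaller.\<close>

lemma active_edge_cases:
  assumes e: "e \<in> active_edges edge_le (tier_edges V t) T"
  obtains W where "W \<in> components (V - {v}) T" "e \<subseteq> W"
  | W u where "W \<in> components (V - {v}) T" "u \<in> W" "e = {u, v}"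
proof -
  obtain a b where ab: "e = {a, b}" "a \<in> V" "b \<in> V" "b < a"
    using e unfolding active_edges_def tier_edges_def by blast
  have ex: "\<exists>W\<in>components (V - {v}) T. x \<in> W" if "x \<in> V" "x \<noteq> v" for x
    using that Union_components[of "V - {v}" T] by blast
  have av: "a \<noteq> v" using Min_le_vertex[OF ab(3)] ab(4) by simp
  then obtain W where W: "W \<in> components (V - {v}) T" "a \<in> W" using ex ab(2) by blast
  show ?thesis
  proof (cases "b = v")
    case True
    then show ?thesis using that(2) W ab(1) by blast
  next
    case False
    then obtain W' where W': "W' \<in> components (V - {v}) T" "b \<in> W'" using ex ab(3) by blast
    have "W = W'"
    proof (rule ccontr)
      assume "W \<noteq> W'"
      then have "edge_le e {attach_vertex T v W, v}"
        using active_edges_iff[OF tree ab(2,3)] e ab attach_vertex(2)[OF W(1)]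
          attach_edge_separates_components[OF W(1) W'(1) _ W(2) W'(2)] by auto
      moreover have "v < b" using Min_le_vertex[OF ab(3)] False by simp
      moreover have "v \<le> attach_vertex T v W"
        using attach_vertex(1)[OF W(1)] components_subset[OF W(1)] Min_le_vertex by blast
      \<comment> \<open>Both ends of \<open>e\<close> exceed \<open>v\<close>, while the attaching
        edge has minimum \<open>v\<close>.\<close>
      ultimately show False using ab(1,4) by (simp add: edge_le_def)
    qed
    then show ?thesis using that(1) W W' ab(1) by blast
  qed
qed

lemma external_activity_recursion:
  "external_activity edge_le (tier_edges V t) T =
    (\<Sum>W\<in>components (V - {v}) T.
      local_weight t T v W + external_activity edge_le (tier_edges W t) (induced_edges T W))"
proof -
  let ?S = "components (V - {v}) T"
  let ?A = "active_edges edge_le (tier_edges V t) T"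
  \<comment> \<open>\<open>B W\<close> will be the active edges from \<open>v\<close> into
    \<open>W\<close>, and \<open>D W\<close> those inside \<open>W\<close>; together they partition
    \<open>?A\<close>.\<close>
  define B where "B W = (\<lambda>u. {u, v}) ` {u \<in> W. t u > t v \<and> u < attach_vertex T v W}" for W
  define D where "D W = active_edges edge_le (tier_edges W t) (induced_edges T W)" for W
  have finV: "finite V" using tree unfolding is_tree_def simple_graph_def by simp
  have finS: "finite ?S"
    by (rule finite_subset[of _ "Pow V"]) (use finV components_subset[of _ "V - {v}" T] in auto)
  have B: "B W = {{u, v} | u. u \<in> W \<and> {u, v} \<in> ?A}" if "W \<in> ?S" for W
    using active_edge_at_Min_iff[OF that] unfolding B_def by auto
  have D: "D W = {e \<in> ?A. e \<subseteq> W}" if "W \<in> ?S" for W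
    unfolding D_def by (rule active_edges_component[OF that])
  have vW: "v \<notin> W" if "W \<in> ?S" for W using components_subset[OF that] by blast
  have finA: "finite ?A" using finV finite_tier_edges finite_active_edges by blast
  have fin: "finite (B W)" "finite (D W)" if "W \<in> ?S" for W
    by (rule finite_subset[OF _ finA], use B[OF that] D[OF that] in auto)+
  have "?A = (\<Union>W\<in>?S. B W \<union> D W)"
  proof
    show "?A \<subseteq> (\<Union>W\<in>?S. B W \<union> D W)"
    proof
      fix e assume e: "e \<in> ?A"
      then show "e \<in> (\<Union>W\<in>?S. B W \<union> D W)"
        by (cases rule: active_edge_cases) (use e B D in auto)
    qed
  qed (use B D in auto)
  moreover have "(B W \<union> D W) \<inter> (B W' \<union> D W') = {}" if "W \<in> ?S" "W' \<in> ?S" "W \<noteq> W'" for W W'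
  proof -
    \<comment> \<open>Each edge assigned to \<open>W\<close> meets \<open>W\<close> and otherwise
      contains at most \<open>v\<close>, so it cannot also be assigned to a component disjoint from
      \<open>W\<close>.\<close>
    have meet: "e \<inter> W \<noteq> {} \<and> e \<subseteq> insert v W" if "W \<in> ?S" "e \<in> B W \<union> D W" for e W
    proof (cases "e \<in> B W")
      case True
      then show ?thesis using B[OF that(1)] by auto
    next
      case False
      then have "e \<in> ?A" "e \<subseteq> W" using that D by auto
      then show ?thesis by (auto simp: active_edges_def tier_edges_def)
    qed
    show ?thesis
      using meet[OF that(1)] meet[OF that(2)] vW[OF that(1)] vW[OF that(2)]
        components_disjoint[OF that] by blast
  qed
  ultimately have "card ?A = (\<Sum>W\<in>?S. card (B W \<union> D W))"
    using finS fin by (simp add: card_UN_disjoint)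
  also have "\<dots> = (\<Sum>W\<in>?S. local_weight t T v W + card (D W))"
  proof (rule sum.cong)
    fix W assume W: "W \<in> ?S"
    have "B W \<inter> D W = {}" using B[OF W] D[OF W] vW[OF W] by auto
    moreover have "card (B W) = local_weight t T v W"
      unfolding B_def local_weight_def
      by (rule card_image) (auto simp: inj_on_def doubleton_eq_iff)
    ultimately show "card (B W \<union> D W) = local_weight t T v W + card (D W)"
      using fin[OF W] by (simp add: card_Un_disjoint)
  qed simp
  finally show ?thesis by (simp add: external_activity_eq_card D_def)
qed

end

text \<open>Both sides obey the same recursion, so induction along \<open>weight\<close> applies.
  The vertex set is arbitrary so that the induction hypothesis covers the components.\<close>

theorem weight_eq_external_activity:
  assumes "is_tree V T"
  shows "weight t V T = external_activity edge_le (tier_edges V t) T"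
  using assms
proof (induction t V T rule: weight.induct)
  case (1 t V T)
  have V: "finite V" "V \<noteq> {}"
    using "1.prems" unfolding is_tree_def simple_graph_def connected_graph_def by auto
  show ?case
  proof (cases "card V > 1")
    case True
    interpret tree_minus_Min V T "Min V" using "1.prems" V by unfold_locales auto
    show ?thesis
      using True V "1.IH" is_tree_component[OF "1.prems"]
      by (subst weight.simps) (simp add: external_activity_recursion)
  next
    case False
    moreover have "card V \<noteq> 0" using V by simp
    ultimately have "card V = 1" by linarith
    then obtain x where "V = {x}" by (auto simp: card_1_singleton_iff)
    \<comment> \<open>A single vertex leaves no edge to be active, matching the default value 0 of
      \<open>weight\<close>.\<close>
    then have "tier_edges V t = {}" by (auto simp: tier_edges_def)
    then show ?thesis
      using False by (subst weight.simps) (simp add: external_activity_def)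
  qed
qed

theorem theorem2p7:
  fixes n m :: nat and E :: "nat set set" and t :: "nat \<Rightarrow> nat"
  assumes "n \<ge> 1" and "m \<ge> 2" and "tiered_tree n m E t"
  shows "weight t {1..n} E = external_activity edge_le (tier_graph n t) E"
proof -
  have "tier_graph n t = tier_edges {1..n} t"
    by (simp add: tier_graph_def tier_edges_def)
  then show ?thesis
    using assms(3) weight_eq_external_activity[of "{1..n}" E t] unfolding tiered_tree_def by simp
qed

end
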